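(* Let $(T,s_T)$ be an alternating signed tree. Then $\mathrm{LIN}(T,s_T)=\omega^{s_T(\emptyset)}\times L$ for some bounded, countable, discrete linear order $L$ of finite Hausdorff rank. Consequently $\mathrm{LIN}(T,s_T)$ is a countable discrete indecomposable scattered linear order of finite Hausdorff rank.
   Context: Trees: a finite tree is a nonempty finite set $T\subseteq\omega^{<\omega}$ closed under initial segments, root $\emptyset$, $\sigma*x$ is $\sigma$ extended by $x$; in standard labelling, with $w(T;\sigma)$ the number of children of $\sigma$, $\sigma*x\in T$ iff $x<w(T;\sigma)$. A finite signed tree is $(T,s_T)$ with $s_T:T\to\{+,-\}$. It is alternating if for every $\sigma\in T$, $w(T;\sigma)$ is even and $s_T(\sigma*x)=(-1)^x$ (i.e. $+$ for even $x$, $-$ for odd $x$) for every $x<w(T;\sigma)$. $A\times B$ denotes the lexicographic product $\sum_{a\in A}B$ (first coordinate dominant); $\omega^+:=\omega$, $\omega^-:=\omega^*$ (reverse of $\omega$). $\mathrm{LIN}(T,s_T,\sigma):=\omega^{s_T(\sigma)}\times\big(\sum_{x<w(T;\sigma)}\mathrm{LIN}(T,s_T,\sigma*x)\big)$, the empty sum being $\mathbf 1$, and $\mathrm{LIN}(T,s_T):=\mathrm{LIN}(T,s_T,\emptyset)$. A linear order is discrete if every element other than a maximum has an immediate successor and every element other than a minimum has an immediate predecessor; bounded means it has a minimum and a maximum. $L$ is indecomposable if whenever $L$ embeds into $A+B$, $L$ embeds into $A$ or into $B$. Scattered means $\mathbb Q$ does not embed. Hausdorff rank: $\sim_0$ is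 equality; for $\alpha>0$ and $x<y$, $x\sim_\alpha y$ iff for some $\beta<\alpha$ only finitely many $\sim_\beta$-classes meet $[x,y]$; $L^{(\alpha)}$ is the ordered set of $\sim_\alpha$-classes; $\mathrm{rk}(L)$ is the least $\alpha$ with $L^{(\alpha)}$ finite ($\infty$ if none). *)

theory Defs
  imports Complex_Main "HOL-Library.Countable_Set" "HOL-Library.Sublist"
begin

text \<open>
  A linear order is a reflexive relation \<open>r\<close> with \<^term>\<open>Linear_order r\<close>; its underlying
  set is \<^term>\<open>Field r\<close>, and the orders \<open>\<omega>\<close> and \<open>{x. x < n}\<close> are \<^term>\<open>natLeq\<close> and
  \<^term>\<open>natLeq_on n\<close>.
\<close>

section \<open>Isomorphism, embedding, sums and products\<close>

text \<open>For arbitrary relations, the library's \<^const>\<open>iso\<close> is bijectivity between the fields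
  together with preservation and reflection of the relation (\<open>iso_iff2\<close>).\<close>

definition lin_iso :: "'a rel \<Rightarrow> 'b rel \<Rightarrow> bool"
  where "lin_iso r r' \<longleftrightarrow> (\<exists>f. iso r r' f)"

text \<open>The library's \<^const>\<open>embed\<close> is restricted to initial segments, so it is not the notion
  needed here.\<close>

definition lin_embeds :: "'a rel \<Rightarrow> 'b rel \<Rightarrow> bool"
  where "lin_embeds r r' \<longleftrightarrow>
    (\<exists>f. inj_on f (Field r) \<and> f ` Field r \<subseteq> Field r' \<and>
      (\<forall>a\<in>Field r. \<forall>b\<in>Field r. (a, b) \<in> r \<longleftrightarrow> (f a, f b) \<in> r'))"

definition lin_sum :: "'i rel \<Rightarrow> ('i \<Rightarrow> 'a rel) \<Rightarrow> ('i \<times> 'a) rel"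
  where "lin_sum I R =
    {((i, a), (j, b)) | i a j b.
       i \<in> Field I \<and> j \<in> Field I \<and> a \<in> Field (R i) \<and> b \<in> Field (R j) \<and>
       (i \<noteq> j \<and> (i, j) \<in> I \<or> i = j \<and> (a, b) \<in> R i)}"

definition lin_prod :: "'a rel \<Rightarrow> 'b rel \<Rightarrow> ('a \<times> 'b) rel"
  where "lin_prod A B = lin_sum A (\<lambda>_. B)"

definition lin_plus :: "'a rel \<Rightarrow> 'b rel \<Rightarrow> ('a + 'b) rel"
  where "lin_plus A B =
    {(Inl a, Inl a') | a a'. (a, a') \<in> A} \<union>
    {(Inr b, Inr b') | b b'. (b, b') \<in> B} \<union>
    {(Inl a, Inr b) | a b. a \<in> Field A \<and> b \<in> Field B}"

lemma lin_sum_cong [fundef_cong]: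
  assumes "I = I'" and "\<And>i. i \<in> Field I' \<Longrightarrow> R i = R' i"
  shows "lin_sum I R = lin_sum I' R'"
  using assms unfolding lin_sum_def by auto


section \<open>Properties of linear orders\<close>

definition lin_max :: "'a rel \<Rightarrow> 'a \<Rightarrow> bool"
  where "lin_max L x \<longleftrightarrow> x \<in> Field L \<and> (\<forall>y\<in>Field L. (y, x) \<in> L)"

definition lin_min :: "'a rel \<Rightarrow> 'a \<Rightarrow> bool"
  where "lin_min L x \<longleftrightarrow> x \<in> Field L \<and> (\<forall>y\<in>Field L. (x, y) \<in> L)"

definition imm_succ :: "'a rel \<Rightarrow> 'a \<Rightarrow> 'a \<Rightarrow> bool"  \<comment> \<open>\<open>y\<close> immediately succeeds \<open>x\<close>\<close>
  where "imm_succ L x y \<longleftrightarrow>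
    (x, y) \<in> L \<and> x \<noteq> y \<and> (\<forall>z. (x, z) \<in> L \<and> (z, y) \<in> L \<longrightarrow> z = x \<or> z = y)"

definition discrete :: "'a rel \<Rightarrow> bool"
  where "discrete L \<longleftrightarrow>
    (\<forall>x\<in>Field L. \<not> lin_max L x \<longrightarrow> (\<exists>y. imm_succ L x y)) \<and>
    (\<forall>y\<in>Field L. \<not> lin_min L y \<longrightarrow> (\<exists>x. imm_succ L x y))"

definition lin_bounded :: "'a rel \<Rightarrow> bool"
  where "lin_bounded L \<longleftrightarrow> (\<exists>x. lin_min L x) \<and> (\<exists>x. lin_max L x)"

definition scattered :: "'a rel \<Rightarrow> bool"
  where "scattered L \<longleftrightarrow> \<not> lin_embeds {(p :: rat, q). p \<le> q} L"

text \<open>The types of the two summands are parameters, because a definition cannot quantify over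
  types; leaving them as type variables in a theorem covers summands of every type.\<close>

definition indecomposable :: "'b itself \<Rightarrow> 'c itself \<Rightarrow> 'a rel \<Rightarrow> bool"
  where "indecomposable TB TC L \<longleftrightarrow>
    (\<forall>(A :: 'b rel) (B :: 'c rel).
       Linear_order A \<longrightarrow> Linear_order B \<longrightarrow> lin_embeds L (lin_plus A B) \<longrightarrow>
       lin_embeds L A \<or> lin_embeds L B)"


section \<open>Hausdorff rank\<close>

text \<open>The closed interval with end points \<open>x\<close> and \<open>y\<close>, in whichever order they come.\<close>

definition lin_interval :: "'a rel \<Rightarrow> 'a \<Rightarrow> 'a \<Rightarrow> 'a set"
  where "lin_interval L x y =
    {z. (x, z) \<in> L \<and> (z, y) \<in> L \<or> (y, z) \<in> L \<and> (z, x) \<in> L}"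

text \<open>The ordinal index ranges over an arbitrary well-ordered type, whose least element plays
  the role of \<open>0\<close> (there, no \<open>\<beta> < \<alpha>\<close> exists and the relation is equality). Only the
  \<open>\<beta> < \<alpha>\<close> enter at \<open>\<alpha>\<close>, so for the type \<^typ>\<open>nat\<close> the index runs through the finite
  ordinals.\<close>

function hausdorff_sim :: "'a rel \<Rightarrow> 'o::wellorder \<Rightarrow> 'a rel"
  where "hausdorff_sim L \<alpha> =
    {(x, y). x \<in> Field L \<and> y \<in> Field L \<and>
       (x = y \<or>
        (\<exists>\<beta>\<in>{..<\<alpha>}. finite ((\<lambda>z. hausdorff_sim L \<beta> `` {z}) ` lin_interval L x y)))}"
  by pat_completeness auto
termination
  by (relation "inv_image {(\<beta>, \<alpha>). \<beta> < \<alpha>} snd") (auto simp: wf)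

declare hausdorff_sim.simps [simp del]

definition has_hausdorff_rank :: "'a rel \<Rightarrow> 'o::wellorder \<Rightarrow> bool"
  where "has_hausdorff_rank L \<alpha> \<longleftrightarrow>
    finite (Field L // hausdorff_sim L \<alpha>) \<and>
    (\<forall>\<beta><\<alpha>. infinite (Field L // hausdorff_sim L \<beta>))"

definition finite_hausdorff_rank :: "'a rel \<Rightarrow> bool"
  where "finite_hausdorff_rank L \<longleftrightarrow> (\<exists>n :: nat. has_hausdorff_rank L n)"


section \<open>Signed trees\<close>

definition finite_tree :: "nat list set \<Rightarrow> bool"
  where "finite_tree T \<longleftrightarrow>
    finite T \<and> T \<noteq> {} \<and> (\<forall>\<sigma>\<in>T. \<forall>\<tau>. prefix \<tau> \<sigma> \<longrightarrow> \<tau> \<in> T)"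

definition width :: "nat list set \<Rightarrow> nat list \<Rightarrow> nat"
  where "width T \<sigma> = card {x. \<sigma> @ [x] \<in> T}"

definition standard_labelling :: "nat list set \<Rightarrow> bool"
  where "standard_labelling T \<longleftrightarrow> (\<forall>\<sigma>\<in>T. \<forall>x. \<sigma> @ [x] \<in> T \<longleftrightarrow> x < width T \<sigma>)"

datatype sign = Plus | Minus

definition alternating :: "nat list set \<Rightarrow> (nat list \<Rightarrow> sign) \<Rightarrow> bool"
  where "alternating T s \<longleftrightarrow>
    (\<forall>\<sigma>\<in>T. even (width T \<sigma>) \<and>
       (\<forall>x<width T \<sigma>. s (\<sigma> @ [x]) = (if even x then Plus else Minus)))"

fun omega_sign :: "sign \<Rightarrow> nat rel"
  where
    "omega_sign Plus = natLeq"
  | "omega_sign Minus = natLeq\<inverse>"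

text \<open>
  The orders \<open>LIN T s \<sigma>\<close> are built from nested pairs of varying depth. To have them all of one
  type, pairs are flattened by the injective map \<^term>\<open>case_prod Cons\<close>: the element \<open>(n, b)\<close> of
  \<open>\<omega>\<^sup>\<plusminus> \<times> B\<close> becomes \<open>n # b\<close>, and the element \<open>(x, p)\<close> of the sum over the children becomes
  \<open>x # p\<close>. The empty sum is the one-point order on \<open>[]\<close>. The lemma \<open>LIN_unflattened\<close> below
  gives the recursion without this coding. The test \<open>finite T \<and> \<sigma> \<in> T\<close> only serves
  termination.
\<close>

function LIN_at :: "nat list set \<Rightarrow> (nat list \<Rightarrow> sign) \<Rightarrow> nat list \<Rightarrow> nat list rel"
  where "LIN_at T s \<sigma> =
    (if finite T \<and> \<sigma> \<in> T then
       dir_image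
         (lin_prod (omega_sign (s \<sigma>))
           (if width T \<sigma> = 0 then {([], [])}
            else dir_image
                   (lin_sum (natLeq_on (width T \<sigma>)) (\<lambda>x. LIN_at T s (\<sigma> @ [x])))
                   (case_prod Cons)))
         (case_prod Cons)
     else {})"
  by pat_completeness auto
termination
proof (relation "measure (\<lambda>(T, s, \<sigma>). card {\<tau> \<in> T. prefix \<sigma> \<tau>})")
  fix T :: "nat list set" and s :: "nat list \<Rightarrow> sign" and \<sigma> :: "nat list" and x :: nat
  assume *: "finite T \<and> \<sigma> \<in> T"
  have "{\<tau> \<in> T. prefix (\<sigma> @ [x]) \<tau>} \<subset> {\<tau> \<in> T. prefix \<sigma> \<tau>}"
  proof
    show "{\<tau> \<in> T. prefix (\<sigma> @ [x]) \<tau>} \<subseteq> {\<tau> \<in> T. prefix \<sigma> \<tau>}"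
      by (auto dest: append_prefixD)
    have "\<sigma> \<in> {\<tau> \<in> T. prefix \<sigma> \<tau>}" "\<sigma> \<notin> {\<tau> \<in> T. prefix (\<sigma> @ [x]) \<tau>}"
      using * by (auto dest: prefix_length_le)
    then show "{\<tau> \<in> T. prefix (\<sigma> @ [x]) \<tau>} \<noteq> {\<tau> \<in> T. prefix \<sigma> \<tau>}"
      by blast
  qed
  then have "card {\<tau> \<in> T. prefix (\<sigma> @ [x]) \<tau>} < card {\<tau> \<in> T. prefix \<sigma> \<tau>}"
    using * by (intro psubset_card_mono) auto
  then show "((T, s, \<sigma> @ [x]), (T, s, \<sigma>)) \<in> measure (\<lambda>(T, s, \<sigma>). card {\<tau> \<in> T. prefix \<sigma> \<tau>})"
    by simp
qed simp

declare LIN_at.simps [simp del]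

definition LIN :: "nat list set \<Rightarrow> (nat list \<Rightarrow> sign) \<Rightarrow> nat list rel"
  where "LIN T s = LIN_at T s []"

lemma lin_iso_dir_image:
  assumes "inj f"
  shows "lin_iso (dir_image r f) r"
  unfolding lin_iso_def iso_iff2
proof (intro exI conjI ballI)
  have inv: "inv f (f x) = x" for x
    using assms by simp
  show "bij_betw (inv f) (Field (dir_image r f)) (Field r)"
    by (rule bij_betw_byWitness[where f' = f]) (auto simp: dir_image_Field inv)
  fix a b
  assume "a \<in> Field (dir_image r f)" "b \<in> Field (dir_image r f)"
  then obtain a' b' where "a = f a'" "b = f b'"
    by (auto simp: dir_image_Field)
  then show "(a, b) \<in> dir_image r f \<longleftrightarrow> (inv f a, inv f b) \<in> r"
    using assms by (auto simp: dir_image_def inv inj_eq)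
qed

lemma lin_prod_dir_image:
  assumes "inj f"
  shows "dir_image (lin_prod A (dir_image B f)) g =
    dir_image (lin_prod A B) (\<lambda>(a, b). g (a, f b))"
proof -
  have "lin_prod A (dir_image B f) = dir_image (lin_prod A B) (map_prod id f)"
    using assms
    by (auto simp: lin_prod_def lin_sum_def dir_image_Field) (auto simp: dir_image_def inj_eq)
  then show ?thesis
    by (fastforce simp: dir_image_def)
qed

lemma LIN_unflattened:
  assumes "finite T" "\<sigma> \<in> T"
  shows "width T \<sigma> = 0 \<Longrightarrow>
      lin_iso (LIN_at T s \<sigma>) (lin_prod (omega_sign (s \<sigma>)) {((), ())})"
    and "width T \<sigma> \<noteq> 0 \<Longrightarrow>
      lin_iso (LIN_at T s \<sigma>)
        (lin_prod (omega_sign (s \<sigma>))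
          (lin_sum (natLeq_on (width T \<sigma>)) (\<lambda>x. LIN_at T s (\<sigma> @ [x]))))"
proof -
  have inj: "inj (case_prod Cons)" "inj (\<lambda>_ :: unit. [] :: nat list)"
    by (auto simp: inj_def)
  have one: "{([], [])} = dir_image {((), ())} (\<lambda>_. [] :: nat list)"
    by (auto simp: dir_image_def)
  show "lin_iso (LIN_at T s \<sigma>) (lin_prod (omega_sign (s \<sigma>)) {((), ())})" if "width T \<sigma> = 0"
  proof -
    have "LIN_at T s \<sigma> =
        dir_image (lin_prod (omega_sign (s \<sigma>)) {((), ())}) (\<lambda>(n, b). case_prod Cons (n, []))"
      unfolding LIN_at.simps[of T s \<sigma>] using assms that
      by (simp only: simp_thms if_True one lin_prod_dir_image[OF inj(2)])
    then show ?thesis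
      by (simp only:) (rule lin_iso_dir_image, auto simp: inj_def)
  qed
  show "lin_iso (LIN_at T s \<sigma>)
        (lin_prod (omega_sign (s \<sigma>))
          (lin_sum (natLeq_on (width T \<sigma>)) (\<lambda>x. LIN_at T s (\<sigma> @ [x]))))" if "width T \<sigma> \<noteq> 0"
  proof -
    let ?S = "lin_sum (natLeq_on (width T \<sigma>)) (\<lambda>x. LIN_at T s (\<sigma> @ [x]))"
    have "LIN_at T s \<sigma> =
        dir_image (lin_prod (omega_sign (s \<sigma>)) ?S) (\<lambda>(n, b). case_prod Cons (n, case_prod Cons b))"
      unfolding LIN_at.simps[of T s \<sigma>] using assms that
      by (simp only: simp_thms if_True if_False lin_prod_dir_image[OF inj(1)])
    then show ?thesis
      by (simp only:) (rule lin_iso_dir_image, auto simp: inj_def)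
  qed
qed

end

theory Submission
  imports Defs
begin

text \<open>
  The sum over the children of a node is bounded, discrete and of finite rank, by induction up the
  tree: with alternating signs, a cut between neighbouring summands has end points on both sides or
  on neither. An interval of \<open>\<omega>\<^sup>\<plusminus> \<times> L\<close> meets only finitely many copies of \<open>L\<close>, so each product
  raises the rank by at most one. Above each of its points, \<open>\<omega> \<times> L\<close> contains a copy of itself, and
  this gives indecomposability, dually for \<open>\<omega>\<^sup>*\<close>. Scatteredness follows from finite rank.
\<close>

section \<open>Linear orders and embeddings\<close>

text \<open>Boundedness carries the induction, and it belongs to the sums over children, not to the
  orders \<open>LIN_at\<close>. If L is bounded, \<omega> \<times> L begins with the first point of
  its first copy of L and has no last copy; the reverse of \<omega> behaves dually. So every
  \<open>LIN_at\<close> below has exactly one end point, on the side given by its sign, and a sum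
  over an even positive number of children is bounded again. Boundedness of L is in turn what makes
  the product discrete: each cut between consecutive copies of L has a last point on its left and a
  first point on its right. For the rank it is enough to keep some finite level with finitely many
  classes; the least such level is never computed. As all the orders are coded on
  \<open>nat list\<close>, each property is also carried across the flattening map.\<close>

lemma Linear_order_reflD: "Linear_order r \<Longrightarrow> x \<in> Field r \<Longrightarrow> (x, x) \<in> r"
  by (auto simp: order_on_defs refl_on_def)

lemma Linear_order_transD: "Linear_order r \<Longrightarrow> (x, y) \<in> r \<Longrightarrow> (y, z) \<in> r \<Longrightarrow> (x, z) \<in> r"
  by (auto simp: order_on_defs dest: transD)

lemma Linear_order_antisymD: "Linear_order r \<Longrightarrow> (x, y) \<in> r \<Longrightarrow> (y, x) \<in> r \<Longrightarrow> x = y"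
  by (auto simp: order_on_defs dest: antisymD)

lemma Linear_order_totalD:
  "Linear_order r \<Longrightarrow> x \<in> Field r \<Longrightarrow> y \<in> Field r \<Longrightarrow> (x, y) \<in> r \<or> (y, x) \<in> r"
  by (metis Linear_order_reflD order_on_defs(3) total_on_def)

lemma Linear_orderI:
  assumes "\<And>x. x \<in> Field r \<Longrightarrow> (x, x) \<in> r"
    and "\<And>x y z. (x, y) \<in> r \<Longrightarrow> (y, z) \<in> r \<Longrightarrow> (x, z) \<in> r"
    and "\<And>x y. (x, y) \<in> r \<Longrightarrow> (y, x) \<in> r \<Longrightarrow> x = y"
    and "\<And>x y. x \<in> Field r \<Longrightarrow> y \<in> Field r \<Longrightarrow> (x, y) \<in> r \<or> (y, x) \<in> r"
  shows "Linear_order r"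
  unfolding order_on_defs refl_on_def trans_def antisym_def total_on_def
  using assms by (auto simp: Field_def)

lemma lin_embeds_trans:
  assumes "lin_embeds r r'" "lin_embeds r' r''"
  shows "lin_embeds r r''"
proof -
  obtain f where f: "inj_on f (Field r)" "f ` Field r \<subseteq> Field r'"
    "\<forall>a\<in>Field r. \<forall>b\<in>Field r. (a, b) \<in> r \<longleftrightarrow> (f a, f b) \<in> r'"
    using assms(1) unfolding lin_embeds_def by blast
  obtain g where g: "inj_on g (Field r')" "g ` Field r' \<subseteq> Field r''"
    "\<forall>a\<in>Field r'. \<forall>b\<in>Field r'. (a, b) \<in> r' \<longleftrightarrow> (g a, g b) \<in> r''"
    using assms(2) unfolding lin_embeds_def by blast
  have "inj_on (g \<circ> f) (Field r)"
    using f(1,2) g(1) by (auto intro: comp_inj_on inj_on_subset)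
  then show ?thesis
    unfolding lin_embeds_def using f g by (intro exI[of _ "g \<circ> f"]) (auto simp: image_subset_iff)
qed

lemma in_dir_image: "inj f \<Longrightarrow> (f a, f b) \<in> dir_image r f \<longleftrightarrow> (a, b) \<in> r"
  by (auto simp: dir_image_def inj_eq)

lemma lin_embeds_dir_image:
  assumes "inj f"
  shows "lin_embeds (dir_image r f) r" "lin_embeds r (dir_image r f)"
proof -
  have inv: "inv f (f x) = x" for x
    using assms by simp
  show "lin_embeds r (dir_image r f)"
    unfolding lin_embeds_def dir_image_Field
    using inj_on_subset[OF assms subset_UNIV] in_dir_image[OF assms] by blast
  show "lin_embeds (dir_image r f) r"
    unfolding lin_embeds_def dir_image_Field
    by (intro exI[of _ "inv f"]) (auto simp: in_dir_image[OF assms] inv intro: inj_onI)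
qed

section \<open>Indecomposability: relabelling, a sufficient condition, reversal\<close>

lemma indecomposable_dir_image:
  assumes "inj f" "indecomposable TYPE('b) TYPE('c) L"
  shows "indecomposable TYPE('b) TYPE('c) (dir_image L f)"
  unfolding indecomposable_def
proof (intro allI impI)
  fix A :: "'b rel" and B :: "'c rel"
  assume "Linear_order A" "Linear_order B" "lin_embeds (dir_image L f) (lin_plus A B)"
  moreover from this have "lin_embeds L (lin_plus A B)"
    using lin_embeds_trans[OF lin_embeds_dir_image(2)[OF assms(1)]] by blast
  ultimately have "lin_embeds L A \<or> lin_embeds L B"
    using assms(2) by (simp add: indecomposable_def)
  then show "lin_embeds (dir_image L f) A \<or> lin_embeds (dir_image L f) B"
    by (auto intro: lin_embeds_trans[OF lin_embeds_dir_image(1)[OF assms(1)]])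
qed

text \<open>If an embedding into \<open>lin_plus A B\<close> sends some \<open>x\<close> into
  \<open>B\<close>, then everything above \<open>x\<close> lands in \<open>B\<close> too, and
  composing with a copy of \<open>L\<close> above \<open>x\<close> puts all of \<open>L\<close> into
  \<open>B\<close>. Otherwise the whole image lies in \<open>A\<close>.\<close>

lemma indecomposable_if_self_embeddings_above:
  assumes "\<And>x. x \<in> Field L \<Longrightarrow>
    \<exists>g. inj_on g (Field L) \<and> g ` Field L \<subseteq> {y. (x, y) \<in> L} \<and>
      (\<forall>a\<in>Field L. \<forall>b\<in>Field L. (a, b) \<in> L \<longleftrightarrow> (g a, g b) \<in> L)"
  shows "indecomposable TYPE('b) TYPE('c) L"
  unfolding indecomposable_def
proof (intro allI impI)
  fix A :: "'b rel" and B :: "'c rel"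
  assume "lin_embeds L (lin_plus A B)"
  then obtain f where f: "inj_on f (Field L)" "f ` Field L \<subseteq> Field (lin_plus A B)"
    "\<forall>a\<in>Field L. \<forall>b\<in>Field L. (a, b) \<in> L \<longleftrightarrow> (f a, f b) \<in> lin_plus A B"
    unfolding lin_embeds_def by blast
  show "lin_embeds L A \<or> lin_embeds L B"
  proof (cases "\<forall>x\<in>Field L. isl (f x)")
    case True
    then have Inl: "f x = Inl (projl (f x))" if "x \<in> Field L" for x
      using that by simp
    have "lin_embeds L A"
      unfolding lin_embeds_def
    proof (intro exI[of _ "projl \<circ> f"] conjI ballI)
      show "inj_on (projl \<circ> f) (Field L)"
        using f(1) Inl by (metis (no_types, lifting) comp_apply inj_on_def)
      show "(projl \<circ> f) ` Field L \<subseteq> Field A"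
      proof clarsimp
        fix x assume "x \<in> Field L"
        then have "Inl (projl (f x)) \<in> Field (lin_plus A B)"
          using f(2) Inl by (metis image_subset_iff)
        then show "projl (f x) \<in> Field A"
          by (auto simp: lin_plus_def Field_def)
      qed
      fix a b assume "a \<in> Field L" "b \<in> Field L"
      then have "(a, b) \<in> L \<longleftrightarrow> (Inl (projl (f a)), Inl (projl (f b))) \<in> lin_plus A B"
        using f(3) Inl by metis
      then show "(a, b) \<in> L \<longleftrightarrow> ((projl \<circ> f) a, (projl \<circ> f) b) \<in> A"
        by (simp add: lin_plus_def)
    qed
    then show ?thesis ..
  next
    case False
    then obtain x b where x: "x \<in> Field L" "f x = Inr b"
      by (metis sum.collapse(2))
    obtain g where g: "inj_on g (Field L)" "g ` Field L \<subseteq> {y. (x, y) \<in> L}"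
      "\<forall>a\<in>Field L. \<forall>b\<in>Field L. (a, b) \<in> L \<longleftrightarrow> (g a, g b) \<in> L"
      using assms[OF x(1)] by blast
    have gF: "g y \<in> Field L" if "y \<in> Field L" for y
      using g(2) that by (auto intro: FieldI2)
    have Inr: "f (g y) = Inr (projr (f (g y)))" if "y \<in> Field L" for y
    proof -
      have "(f x, f (g y)) \<in> lin_plus A B"
        using f(3) x(1) gF[OF that] g(2) that by auto
      then show ?thesis
        using x(2) by (auto simp: lin_plus_def)
    qed
    have "lin_embeds L B"
      unfolding lin_embeds_def
    proof (intro exI[of _ "projr \<circ> f \<circ> g"] conjI ballI)
      show "inj_on (projr \<circ> f \<circ> g) (Field L)"
      proof (rule inj_onI)
        fix a b assume "a \<in> Field L" "b \<in> Field L" "(projr \<circ> f \<circ> g) a = (projr \<circ> f \<circ> g) b"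
        then have "f (g a) = f (g b)" "a \<in> Field L" "b \<in> Field L"
          using Inr by (metis comp_apply)+
        then show "a = b"
          using f(1) g(1) gF by (auto dest: inj_onD)
      qed
      show "(projr \<circ> f \<circ> g) ` Field L \<subseteq> Field B"
      proof clarsimp
        fix y assume "y \<in> Field L"
        then have "Inr (projr (f (g y))) \<in> Field (lin_plus A B)"
          using f(2) Inr gF by (metis image_subset_iff)
        then show "projr (f (g y)) \<in> Field B"
          by (auto simp: lin_plus_def Field_def)
      qed
      fix a b assume "a \<in> Field L" "b \<in> Field L"
      then have "(a, b) \<in> L \<longleftrightarrow> (Inr (projr (f (g a))), Inr (projr (f (g b)))) \<in> lin_plus A B"
        using f(3) g(3) Inr gF by metis
      then show "(a, b) \<in> L \<longleftrightarrow> ((projr \<circ> f \<circ> g) a, (projr \<circ> f \<circ> g) b) \<in> B"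
        by (simp add: lin_plus_def)
    qed
    then show ?thesis ..
  qed
qed

lemma lin_embeds_converse: "lin_embeds (r\<inverse>) (r'\<inverse>) \<longleftrightarrow> lin_embeds r r'"
  unfolding lin_embeds_def by (auto; metis)

text \<open>Reversing an ordered sum also swaps its summands, hence the map \<open>?h\<close>. For
  the same reason the two type parameters trade places in
  \<open>indecomposable_converse\<close>.\<close>

lemma lin_embeds_lin_plus_converse:
  assumes "lin_embeds r (lin_plus A B)"
  shows "lin_embeds (r\<inverse>) (lin_plus (B\<inverse>) (A\<inverse>))"
proof -
  let ?h = "case_sum Inr Inl :: 'b + 'c \<Rightarrow> 'c + 'b"
  have inj: "inj ?h"
    by (auto simp: inj_def split: sum.splits)
  have "lin_embeds (r\<inverse>) ((lin_plus A B)\<inverse>)"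
    using assms by (simp add: lin_embeds_converse)
  then have "lin_embeds (r\<inverse>) (dir_image ((lin_plus A B)\<inverse>) ?h)"
    using lin_embeds_dir_image(2)[OF inj] by (rule lin_embeds_trans)
  moreover have "dir_image ((lin_plus A B)\<inverse>) ?h = lin_plus (B\<inverse>) (A\<inverse>)"
    by (auto simp: dir_image_def lin_plus_def; force)
  ultimately show ?thesis
    by simp
qed

lemma indecomposable_converse:
  assumes "indecomposable TYPE('c) TYPE('b) L"
  shows "indecomposable TYPE('b) TYPE('c) (L\<inverse>)"
  unfolding indecomposable_def
proof (intro allI impI)
  fix A :: "'b rel" and B :: "'c rel"
  assume *: "Linear_order A" "Linear_order B" "lin_embeds (L\<inverse>) (lin_plus A B)"
  then have "lin_embeds L (lin_plus (B\<inverse>) (A\<inverse>))"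
    using lin_embeds_lin_plus_converse[of "L\<inverse>"] by simp
  moreover have "Linear_order (A\<inverse>)" "Linear_order (B\<inverse>)"
    using * by auto
  ultimately have "lin_embeds L (A\<inverse>) \<or> lin_embeds L (B\<inverse>)"
    using assms unfolding indecomposable_def by blast
  then show "lin_embeds (L\<inverse>) A \<or> lin_embeds (L\<inverse>) B"
    using lin_embeds_converse[of L "A\<inverse>"] lin_embeds_converse[of L "B\<inverse>"] by simp
qed


section \<open>Lexicographic sums\<close>

lemma in_lin_sum:
  "((i, a), (j, b)) \<in> lin_sum I R \<longleftrightarrow>
    i \<in> Field I \<and> j \<in> Field I \<and> a \<in> Field (R i) \<and> b \<in> Field (R j) \<and>
    (i \<noteq> j \<and> (i, j) \<in> I \<or> i = j \<and> (a, b) \<in> R i)"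
  by (auto simp: lin_sum_def)

lemma Field_lin_sum:
  assumes "\<And>i. i \<in> Field I \<Longrightarrow> Linear_order (R i)"
  shows "Field (lin_sum I R) = Sigma (Field I) (\<lambda>i. Field (R i))"
proof
  show "Field (lin_sum I R) \<subseteq> Sigma (Field I) (\<lambda>i. Field (R i))"
    by (auto simp: lin_sum_def Field_def)
  have "((i, a), (i, a)) \<in> lin_sum I R" if "i \<in> Field I" "a \<in> Field (R i)" for i a
    using that assms by (simp add: in_lin_sum Linear_order_reflD)
  then show "Sigma (Field I) (\<lambda>i. Field (R i)) \<subseteq> Field (lin_sum I R)"
    by (auto intro: FieldI1)
qed

lemma Linear_order_lin_sum:
  assumes I: "Linear_order I" and R: "\<And>i. i \<in> Field I \<Longrightarrow> Linear_order (R i)"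
  shows "Linear_order (lin_sum I R)"
proof (rule Linear_orderI)
  note F = Field_lin_sum[of I R, OF R]
  show "(x, x) \<in> lin_sum I R" if "x \<in> Field (lin_sum I R)" for x
    using that R by (auto simp: F in_lin_sum Linear_order_reflD)
  show "(x, y) \<in> lin_sum I R \<or> (y, x) \<in> lin_sum I R"
    if "x \<in> Field (lin_sum I R)" "y \<in> Field (lin_sum I R)" for x y
    using that R I by (cases x; cases y) (auto simp: F in_lin_sum dest: Linear_order_totalD)
  show "x = y" if "(x, y) \<in> lin_sum I R" "(y, x) \<in> lin_sum I R" for x y
    using that R I by (cases x; cases y) (auto simp: in_lin_sum dest: Linear_order_antisymD)
  show "(x, z) \<in> lin_sum I R" if "(x, y) \<in> lin_sum I R" "(y, z) \<in> lin_sum I R" for x y z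
    using that R I
    by (cases x; cases y; cases z)
      (auto simp: in_lin_sum dest: Linear_order_antisymD Linear_order_transD)
qed

lemma lin_sum_converse: "lin_sum (I\<inverse>) (\<lambda>i. (R i)\<inverse>) = (lin_sum I R)\<inverse>"
  by (auto simp: lin_sum_def)

section \<open>End points and immediate successors in sums\<close>

lemma lin_max_converse: "lin_max (L\<inverse>) = lin_min L"
  by (simp add: fun_eq_iff lin_max_def lin_min_def)

lemma lin_min_converse: "lin_min (L\<inverse>) = lin_max L"
  by (simp add: fun_eq_iff lin_max_def lin_min_def)

lemma imm_succ_converse: "imm_succ (L\<inverse>) x y \<longleftrightarrow> imm_succ L y x"
  by (auto simp: imm_succ_def)

lemma lin_max_lin_sum:
  assumes "\<And>i. i \<in> Field I \<Longrightarrow> Linear_order (R i)" "lin_max I i" "lin_max (R i) a"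
  shows "lin_max (lin_sum I R) (i, a)"
  using assms by (auto simp: lin_max_def in_lin_sum Field_lin_sum)

lemma lin_min_lin_sum:
  assumes "\<And>i. i \<in> Field I \<Longrightarrow> Linear_order (R i)" "lin_min I i" "lin_min (R i) a"
  shows "lin_min (lin_sum I R) (i, a)"
  using assms by (auto simp: lin_min_def in_lin_sum Field_lin_sum)

lemma not_lin_max_lin_sum:
  assumes "\<And>i. i \<in> Field I \<Longrightarrow> Linear_order (R i)" "\<And>i. i \<in> Field I \<Longrightarrow> Field (R i) \<noteq> {}"
    and "Linear_order I" "\<nexists>i. lin_max I i"
  shows "\<not> lin_max (lin_sum I R) x"
proof
  assume max: "lin_max (lin_sum I R) x"
  obtain i a where x: "x = (i, a)"
    by fastforce
  then have i: "i \<in> Field I"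
    using max assms(1) by (auto simp: lin_max_def Field_lin_sum)
  then obtain j where j: "j \<in> Field I" "(j, i) \<notin> I"
    using assms(4) by (auto simp: lin_max_def)
  obtain b where "b \<in> Field (R j)"
    using assms(2)[OF j(1)] by blast
  then have "(j, b) \<in> Field (lin_sum I R)"
    using j assms(1) by (simp add: Field_lin_sum)
  then have "((j, b), (i, a)) \<in> lin_sum I R"
    using max x by (simp add: lin_max_def)
  then show False
    using j assms(3) by (auto simp: in_lin_sum Linear_order_reflD)
qed

lemma imm_succ_lin_sum_same:
  assumes "Linear_order I" "i \<in> Field I" "imm_succ (R i) a b"
  shows "imm_succ (lin_sum I R) (i, a) (i, b)"
  using assms unfolding imm_succ_def
  by (auto simp: in_lin_sum intro: FieldI1 FieldI2 dest: Linear_order_antisymD)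

lemma imm_succ_lin_sum_next:
  assumes "\<And>i. i \<in> Field I \<Longrightarrow> Linear_order (R i)"
    and "imm_succ I i j" "lin_max (R i) a" "lin_min (R j) b"
  shows "imm_succ (lin_sum I R) (i, a) (j, b)"
proof -
  have ij: "(i, j) \<in> I" "i \<noteq> j" "i \<in> Field I" "j \<in> Field I"
    using assms(2) by (auto simp: imm_succ_def intro: FieldI1 FieldI2)
  show ?thesis
    unfolding imm_succ_def
  proof (intro conjI allI impI)
    show "((i, a), (j, b)) \<in> lin_sum I R" "(i, a) \<noteq> (j, b)"
      using ij assms(3,4) by (auto simp: in_lin_sum lin_max_def lin_min_def)
    fix z assume *: "((i, a), z) \<in> lin_sum I R \<and> (z, (j, b)) \<in> lin_sum I R"
    obtain k c where z: "z = (k, c)"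
      by fastforce
    have "k = i \<or> k = j"
      using assms(2) * by (auto simp: z in_lin_sum imm_succ_def)
    then show "z = (i, a) \<or> z = (j, b)"
    proof
      assume k: "k = i"
      then have "(a, c) \<in> R i" "c \<in> Field (R i)"
        using * by (auto simp: z in_lin_sum)
      then have "c = a"
        using assms(1)[OF ij(3)] assms(3) by (auto simp: lin_max_def dest: Linear_order_antisymD)
      then show ?thesis
        by (simp add: z k)
    next
      assume k: "k = j"
      then have "(c, b) \<in> R j" "c \<in> Field (R j)"
        using * ij by (auto simp: z in_lin_sum)
      then have "c = b"
        using assms(1)[OF ij(4)] assms(4) by (auto simp: lin_min_def dest: Linear_order_antisymD)
      then show ?thesis
        by (simp add: z k)
    qed
  qed
qed

text \<open>A point that is not last in its summand has its successor there; a last point needs the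
  first point of the next summand, which \<open>cut\<close> supplies. The condition is an
  implication in one direction only, so that the reversed sum can use the opposite one for
  predecessors.\<close>

lemma imm_succ_lin_sum_exists:
  assumes I: "Linear_order I" "discrete I"
    and R: "\<And>i. i \<in> Field I \<Longrightarrow> Linear_order (R i)" "\<And>i. i \<in> Field I \<Longrightarrow> discrete (R i)"
    and cut: "\<And>i j. imm_succ I i j \<Longrightarrow> Ex (lin_max (R i)) \<Longrightarrow> Ex (lin_min (R j))"
    and x: "x \<in> Field (lin_sum I R)" "\<not> lin_max (lin_sum I R) x"
  shows "\<exists>y. imm_succ (lin_sum I R) x y"
proof -
  obtain i a where ia: "x = (i, a)" "i \<in> Field I" "a \<in> Field (R i)"
    using x(1) R(1) by (auto simp: Field_lin_sum)
  show ?thesis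
  proof (cases "lin_max (R i) a")
    case True
    then have "\<not> lin_max I i"
      using x(2) R(1) ia(1) lin_max_lin_sum by metis
    then obtain j where j: "imm_succ I i j"
      using I(2) ia(2) by (auto simp: discrete_def)
    then obtain b where "lin_min (R j) b"
      using cut True by blast
    then show ?thesis
      using imm_succ_lin_sum_next[of I R, OF R(1) j True] ia(1) by blast
  next
    case False
    then obtain b where "imm_succ (R i) a b"
      using R(2)[OF ia(2)] ia(3) by (auto simp: discrete_def)
    then show ?thesis
      using imm_succ_lin_sum_same I(1) ia by metis
  qed
qed

lemma discrete_converse: "discrete (L\<inverse>) \<longleftrightarrow> discrete L"
  unfolding discrete_def lin_max_converse lin_min_converse imm_succ_converse by auto

lemma discrete_lin_sum:
  assumes I: "Linear_order I" "discrete I"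
    and R: "\<And>i. i \<in> Field I \<Longrightarrow> Linear_order (R i)" "\<And>i. i \<in> Field I \<Longrightarrow> discrete (R i)"
    and cut: "\<And>i j. imm_succ I i j \<Longrightarrow> Ex (lin_max (R i)) \<longleftrightarrow> Ex (lin_min (R j))"
  shows "discrete (lin_sum I R)"
  unfolding discrete_def
proof (intro conjI ballI impI)
  fix x assume "x \<in> Field (lin_sum I R)" "\<not> lin_max (lin_sum I R) x"
  then show "\<exists>y. imm_succ (lin_sum I R) x y"
    using imm_succ_lin_sum_exists[of I R] assms by blast
next
  fix y assume "y \<in> Field (lin_sum I R)" "\<not> lin_min (lin_sum I R) y"
  \<comment> \<open>A predecessor is a successor in the sum of the reversed orders, where the cut
    condition becomes its other implication.\<close>
  then have "\<exists>x. imm_succ (lin_sum (I\<inverse>) (\<lambda>i. (R i)\<inverse>)) y x"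
    using assms
    by (intro imm_succ_lin_sum_exists)
      (simp_all add: lin_sum_converse lin_max_converse lin_min_converse imm_succ_converse
        discrete_converse)
  then show "\<exists>x. imm_succ (lin_sum I R) x y"
    by (simp only: lin_sum_converse imm_succ_converse)
qed

section \<open>Transfer of end points and discreteness along an injective relabelling\<close>

lemma lin_max_dir_image:
  assumes "inj f"
  shows "lin_max (dir_image L f) (f x) \<longleftrightarrow> lin_max L x"
  by (auto simp: lin_max_def dir_image_Field in_dir_image[OF assms] inj_eq[OF assms])

lemma lin_min_dir_image:
  assumes "inj f"
  shows "lin_min (dir_image L f) (f x) \<longleftrightarrow> lin_min L x"
  by (auto simp: lin_min_def dir_image_Field in_dir_image[OF assms] inj_eq[OF assms])

lemma Ex_lin_max_dir_image:
  assumes "inj f"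
  shows "Ex (lin_max (dir_image L f)) \<longleftrightarrow> Ex (lin_max L)"
proof -
  have "Ex (lin_max (dir_image L f)) \<longleftrightarrow> (\<exists>x. lin_max (dir_image L f) (f x))"
    unfolding lin_max_def dir_image_Field by blast
  then show ?thesis
    by (simp add: lin_max_dir_image[OF assms])
qed

lemma Ex_lin_min_dir_image:
  assumes "inj f"
  shows "Ex (lin_min (dir_image L f)) \<longleftrightarrow> Ex (lin_min L)"
proof -
  have "Ex (lin_min (dir_image L f)) \<longleftrightarrow> (\<exists>x. lin_min (dir_image L f) (f x))"
    unfolding lin_min_def dir_image_Field by blast
  then show ?thesis
    by (simp add: lin_min_dir_image[OF assms])
qed

lemma imm_succ_dir_image:
  assumes "inj f" "imm_succ L x y"
  shows "imm_succ (dir_image L f) (f x) (f y)"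
  unfolding imm_succ_def
proof (intro conjI allI impI)
  show "(f x, f y) \<in> dir_image L f" "f x \<noteq> f y"
    using assms by (auto simp: imm_succ_def in_dir_image inj_eq)
  fix z assume *: "(f x, z) \<in> dir_image L f \<and> (z, f y) \<in> dir_image L f"
  then obtain u where "z = f u"
    by (auto simp: dir_image_def)
  then show "z = f x \<or> z = f y"
    using * assms by (auto simp: imm_succ_def in_dir_image[OF assms(1)])
qed

lemma discrete_dir_image:
  assumes "inj f" "discrete L"
  shows "discrete (dir_image L f)"
  unfolding discrete_def dir_image_Field
proof (intro conjI ballI impI; elim imageE; hypsubst)
  fix x assume "x \<in> Field L" "\<not> lin_max (dir_image L f) (f x)"
  then show "\<exists>y. imm_succ (dir_image L f) (f x) y"
    using assms by (meson discrete_def imm_succ_dir_image lin_max_dir_image)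
next
  fix x assume "x \<in> Field L" "\<not> lin_min (dir_image L f) (f x)"
  then show "\<exists>y. imm_succ (dir_image L f) y (f x)"
    using assms by (meson discrete_def imm_succ_dir_image lin_min_dir_image)
qed


section \<open>Finite Hausdorff rank\<close>

lemma hausdorff_sim_iff:
  "(x, y) \<in> hausdorff_sim L \<alpha> \<longleftrightarrow> x \<in> Field L \<and> y \<in> Field L \<and>
    (x = y \<or> (\<exists>\<beta><\<alpha>. finite ((\<lambda>z. hausdorff_sim L \<beta> `` {z}) ` lin_interval L x y)))"
  by (subst hausdorff_sim.simps) auto

lemma hausdorff_sim_mono: "\<alpha> \<le> \<beta> \<Longrightarrow> hausdorff_sim L \<alpha> \<subseteq> hausdorff_sim L \<beta>"
  by (auto simp: hausdorff_sim_iff intro: less_le_trans)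

text \<open>The class of \<open>f z\<close> is the \<open>r'\<close>-saturation of the image of the
  class of \<open>z\<close>, so it depends on that class alone, and \<open>f\<close> cannot increase
  the number of classes met. With \<open>f\<close> the identity this says that coarsening keeps
  finiteness; with a convex embedding it moves the count to another order.\<close>

lemma finite_classes_image:
  assumes "equiv A r" "equiv B r'" "\<And>x y. (x, y) \<in> r \<Longrightarrow> (f x, f y) \<in> r'" "S \<subseteq> A"
    and "finite ((\<lambda>z. r `` {z}) ` S)"
  shows "finite ((\<lambda>z. r' `` {z}) ` f ` S)"
proof -
  have "r' `` {f z} = r' `` (f ` (r `` {z}))" if "z \<in> S" for z
  proof
    have "(z, z) \<in> r"
      using assms(1,4) that by (auto elim!: equivE simp: refl_on_def)
    then show "r' `` {f z} \<subseteq> r' `` (f ` (r `` {z}))"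
      by auto
    show "r' `` (f ` (r `` {z})) \<subseteq> r' `` {f z}"
      using assms(2,3) by (auto elim!: equivE dest: transD)
  qed
  then have "(\<lambda>z. r' `` {z}) ` f ` S = (\<lambda>C. r' `` (f ` C)) ` (\<lambda>z. r `` {z}) ` S"
    by (auto simp: image_image)
  then show ?thesis
    using assms(5) by simp
qed

lemma lin_interval_commute: "lin_interval L x y = lin_interval L y x"
  by (auto simp: lin_interval_def)

lemma lin_interval_subset_Field: "lin_interval L x y \<subseteq> Field L"
  by (auto simp: lin_interval_def intro: FieldI1 FieldI2)

lemma lin_interval_triangle:
  assumes "Linear_order L" "y \<in> Field L"
  shows "lin_interval L x z \<subseteq> lin_interval L x y \<union> lin_interval L y z"
proof
  fix u assume u: "u \<in> lin_interval L x z"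
  then have "u \<in> Field L"
    using lin_interval_subset_Field[of L x z] by blast
  then have "(u, y) \<in> L \<or> (y, u) \<in> L"
    using Linear_order_totalD assms by metis
  then show "u \<in> lin_interval L x y \<union> lin_interval L y z"
    using u by (auto simp: lin_interval_def)
qed

text \<open>Only transitivity has content. The two given counts may sit at different levels; both
  stay finite at the larger one, and the interval from \<open>x\<close> to \<open>z\<close> is
  covered by the other two intervals. Raising a count to a coarser level needs the levels below
  \<alpha> to be equivalences already, hence the induction.\<close>

lemma equiv_hausdorff_sim:
  assumes "Linear_order L"
  shows "equiv (Field L) (hausdorff_sim L \<alpha>)"
proof (induction \<alpha> rule: less_induct)
  case (less \<alpha>)
  let ?fin = "\<lambda>\<beta> S. finite ((\<lambda>z. hausdorff_sim L \<beta> `` {z}) ` S)"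
  have mono: "?fin \<beta>' S" if "?fin \<beta> S" "\<beta> \<le> \<beta>'" "\<beta>' < \<alpha>" "S \<subseteq> Field L" for \<beta> \<beta>' S
  proof -
    have "\<beta> < \<alpha>"
      using that(2,3) by simp
    from finite_classes_image[OF less.IH[OF this] less.IH[OF that(3)] _ that(4,1), of "\<lambda>x. x"]
    show ?thesis
      using hausdorff_sim_mono[OF that(2)] by auto
  qed
  show ?case
  proof (rule equivI)
    show "hausdorff_sim L \<alpha> \<subseteq> Field L \<times> Field L" "refl_on (Field L) (hausdorff_sim L \<alpha>)"
      by (auto simp: hausdorff_sim_iff refl_on_def)
    show "sym (hausdorff_sim L \<alpha>)"
      by (rule symI) (auto simp: hausdorff_sim_iff lin_interval_commute)
    show "trans (hausdorff_sim L \<alpha>)"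
    proof (rule transI)
      fix x y z assume xy: "(x, y) \<in> hausdorff_sim L \<alpha>" and yz: "(y, z) \<in> hausdorff_sim L \<alpha>"
      show "(x, z) \<in> hausdorff_sim L \<alpha>"
      proof (cases "x = y \<or> y = z")
        case False
        then obtain \<beta> \<gamma> where *: "\<beta> < \<alpha>" "?fin \<beta> (lin_interval L x y)"
          "\<gamma> < \<alpha>" "?fin \<gamma> (lin_interval L y z)"
          using xy yz by (auto simp: hausdorff_sim_iff)
        have max: "\<beta> \<le> max \<beta> \<gamma>" "\<gamma> \<le> max \<beta> \<gamma>" "max \<beta> \<gamma> < \<alpha>"
          using * by simp_all
        have "?fin (max \<beta> \<gamma>) (lin_interval L x y \<union> lin_interval L y z)"
          using mono[OF *(2) max(1,3) lin_interval_subset_Field]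
            mono[OF *(4) max(2,3) lin_interval_subset_Field]
          by (simp add: image_Un)
        moreover have "lin_interval L x z \<subseteq> lin_interval L x y \<union> lin_interval L y z"
          using lin_interval_triangle[OF assms] xy by (auto simp: hausdorff_sim_iff)
        ultimately have "?fin (max \<beta> \<gamma>) (lin_interval L x z)"
          by (meson finite_subset image_mono)
        then show ?thesis
          using xy yz max(3) by (auto simp: hausdorff_sim_iff)
      qed (use xy yz in auto)
    qed
  qed
qed

lemma finite_classes_mono:
  assumes "Linear_order L" "S \<subseteq> Field L" "\<alpha> \<le> \<beta>"
    and "finite ((\<lambda>z. hausdorff_sim L \<alpha> `` {z}) ` S)"
  shows "finite ((\<lambda>z. hausdorff_sim L \<beta> `` {z}) ` S)"
  using finite_classes_image[OF equiv_hausdorff_sim[OF assms(1)] equiv_hausdorff_sim[OF assms(1)]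
      _ assms(2,4), of "\<lambda>x. x"] hausdorff_sim_mono[OF assms(3)] by auto

text \<open>Minimality comes for free from the well-order on the natural numbers, so from here on
  any level with finitely many classes will do.\<close>

lemma finite_hausdorff_rank_iff:
  "finite_hausdorff_rank L \<longleftrightarrow>
    (\<exists>n :: nat. finite ((\<lambda>z. hausdorff_sim L n `` {z}) ` Field L))"
proof -
  have "Field L // r = (\<lambda>z. r `` {z}) ` Field L" for r :: "'a rel"
    by (auto simp: quotient_def)
  then show ?thesis
    unfolding finite_hausdorff_rank_def has_hausdorff_rank_def
    using exists_least_iff[of "\<lambda>n :: nat. finite (Field L // hausdorff_sim L n)"] by simp
qed

text \<open>Convexity of the image is what makes \<open>\<sim>\<^sub>\<alpha>\<close> pass from \<open>L\<close> to \<open>L'\<close>: the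
  intervals to be counted are the same in both orders.\<close>

definition convex_embedding :: "'a rel \<Rightarrow> 'b rel \<Rightarrow> ('a \<Rightarrow> 'b) \<Rightarrow> bool"
  where "convex_embedding L L' f \<longleftrightarrow> f ` Field L \<subseteq> Field L' \<and>
    (\<forall>x\<in>Field L. \<forall>y\<in>Field L. lin_interval L' (f x) (f y) = f ` lin_interval L x y)"

lemma hausdorff_sim_convex_embedding:
  assumes "Linear_order L" "Linear_order L'" "convex_embedding L L' f"
  shows "(x, y) \<in> hausdorff_sim L \<alpha> \<Longrightarrow> (f x, f y) \<in> hausdorff_sim L' \<alpha>"
proof (induction \<alpha> arbitrary: x y rule: less_induct)
  case (less \<alpha>)
  then have xy: "x \<in> Field L" "y \<in> Field L"
    by (auto simp: hausdorff_sim_iff)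
  then have f: "f x \<in> Field L'" "f y \<in> Field L'"
    "lin_interval L' (f x) (f y) = f ` lin_interval L x y"
    using assms(3) by (auto simp: convex_embedding_def)
  show ?case
  proof (cases "x = y")
    case False
    then obtain \<beta> where \<beta>: "\<beta> < \<alpha>"
      "finite ((\<lambda>z. hausdorff_sim L \<beta> `` {z}) ` lin_interval L x y)"
      using less.prems by (auto simp: hausdorff_sim_iff)
    \<comment> \<open>By the induction hypothesis \<open>f\<close> carries \<beta>-classes into
      \<beta>-classes.\<close>
    have "finite ((\<lambda>z. hausdorff_sim L' \<beta> `` {z}) ` lin_interval L' (f x) (f y))"
      unfolding f(3)
      by (rule finite_classes_image[OF equiv_hausdorff_sim equiv_hausdorff_sim
            less.IH lin_interval_subset_Field \<beta>(2)])
        (use assms \<beta> in auto)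
    then show ?thesis
      using f(1,2) \<beta>(1) by (auto simp: hausdorff_sim_iff)
  qed (use f in \<open>auto simp: hausdorff_sim_iff\<close>)
qed

lemma finite_classes_convex_embedding:
  assumes "Linear_order L" "Linear_order L'" "convex_embedding L L' f"
    and "finite ((\<lambda>z. hausdorff_sim L \<alpha> `` {z}) ` Field L)"
  shows "finite ((\<lambda>z. hausdorff_sim L' \<alpha> `` {z}) ` f ` Field L)"
  by (rule finite_classes_image[OF equiv_hausdorff_sim[OF assms(1)]
        equiv_hausdorff_sim[OF assms(2)] _ order_refl assms(4)])
    (rule hausdorff_sim_convex_embedding[OF assms(1-3)])

lemma convex_embedding_dir_image: "inj f \<Longrightarrow> convex_embedding L (dir_image L f) f"
  unfolding convex_embedding_def dir_image_Field lin_interval_def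
  by (auto simp: dir_image_def inj_eq)

lemma finite_hausdorff_rank_dir_image:
  assumes "inj f" "Linear_order L" "finite_hausdorff_rank L"
  shows "finite_hausdorff_rank (dir_image L f)"
proof -
  have "Linear_order (dir_image L f)"
    by (rule Linear_order_dir_image[OF assms(2) inj_on_subset[OF assms(1) subset_UNIV]])
  then show ?thesis
    using finite_classes_convex_embedding[OF assms(2) _ convex_embedding_dir_image[OF assms(1)]]
      assms(3) by (auto simp: finite_hausdorff_rank_iff dir_image_Field)
qed

text \<open>A point between two points of the \<open>i\<close>-th copy has an index both above and
  below \<open>i\<close>, hence equal to \<open>i\<close> by antisymmetry.\<close>

lemma convex_embedding_Pair:
  assumes "Linear_order I" "\<And>i. i \<in> Field I \<Longrightarrow> Linear_order (R i)" "i \<in> Field I"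
  shows "convex_embedding (R i) (lin_sum I R) (Pair i)"
  using assms
  by (auto simp: convex_embedding_def Field_lin_sum lin_interval_def in_lin_sum
      intro: FieldI1 FieldI2 dest: Linear_order_antisymD)

lemma finite_hausdorff_rank_lin_sum:
  assumes I: "Linear_order I" "finite (Field I)"
    and R: "\<And>i. i \<in> Field I \<Longrightarrow> Linear_order (R i)"
      "\<And>i. i \<in> Field I \<Longrightarrow> finite_hausdorff_rank (R i)"
  shows "finite_hausdorff_rank (lin_sum I R)"
proof -
  let ?S = "lin_sum I R"
  have lin: "Linear_order ?S"
    by (rule Linear_order_lin_sum[OF I(1) R(1)])
  obtain n :: "_ \<Rightarrow> nat" where
    n: "\<And>i. i \<in> Field I \<Longrightarrow> finite ((\<lambda>z. hausdorff_sim (R i) (n i) `` {z}) ` Field (R i))"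
    using R(2) unfolding finite_hausdorff_rank_iff by metis
  \<comment> \<open>A common level for all summands; as a bound, the sum also makes sense for an
    empty index set.\<close>
  define N where "N = (\<Sum>i\<in>Field I. n i)"
  have "finite ((\<lambda>z. hausdorff_sim ?S N `` {z}) ` Pair i ` Field (R i))" if i: "i \<in> Field I" for i
  proof -
    have "n i \<le> N"
      unfolding N_def using i I(2) by (intro member_le_sum) auto
    then have "finite ((\<lambda>z. hausdorff_sim (R i) N `` {z}) ` Field (R i))"
      by (rule finite_classes_mono[OF R(1)[OF i] order_refl _ n[OF i]])
    moreover have "convex_embedding (R i) ?S (Pair i)"
      by (rule convex_embedding_Pair[OF I(1) R(1) i])
    ultimately show ?thesis
      using finite_classes_convex_embedding[OF R(1)[OF i] lin] by blast
  qed
  then have "finite (\<Union>i\<in>Field I. (\<lambda>z. hausdorff_sim ?S N `` {z}) ` Pair i ` Field (R i))"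
    using I(2) by blast
  moreover have "Field ?S = (\<Union>i\<in>Field I. Pair i ` Field (R i))"
    using R(1) by (auto simp: Field_lin_sum)
  ultimately show ?thesis
    unfolding finite_hausdorff_rank_iff by (metis image_UN)
qed

lemma finite_hausdorff_rank_lin_prod:
  assumes I: "Linear_order I" "\<And>i j. finite (lin_interval I i j)"
    and B: "Linear_order B" "finite_hausdorff_rank B"
  shows "finite_hausdorff_rank (lin_prod I B)"
proof -
  let ?S = "lin_prod I B"
  have lin: "Linear_order ?S"
    unfolding lin_prod_def by (intro Linear_order_lin_sum I B)
  have F: "Field ?S = Field I \<times> Field B"
    unfolding lin_prod_def using B(1) by (simp add: Field_lin_sum)
  obtain n :: nat where n: "finite ((\<lambda>z. hausdorff_sim B n `` {z}) ` Field B)"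
    using B(2) unfolding finite_hausdorff_rank_iff by blast
  have fin: "finite ((\<lambda>z. hausdorff_sim ?S n `` {z}) ` Pair i ` Field B)" if i: "i \<in> Field I" for i
  proof -
    have "convex_embedding B ?S (Pair i)"
      unfolding lin_prod_def
      by (rule convex_embedding_Pair[OF I(1) _ i, of "\<lambda>_. B"]) (rule B(1))
    then show ?thesis
      by (rule finite_classes_convex_embedding[OF B(1) lin _ n])
  qed
  \<comment> \<open>One level above \<open>n\<close> the whole product collapses to a single class:
    finitely many copies, each with finitely many classes at level \<open>n\<close>, cover any
    interval.\<close>
  have "(x, y) \<in> hausdorff_sim ?S (Suc n)" if xy: "x \<in> Field ?S" "y \<in> Field ?S" for x y
  proof -
    let ?J = "lin_interval I (fst x) (fst y)"
    have "finite (\<Union>i\<in>?J. (\<lambda>z. hausdorff_sim ?S n `` {z}) ` Pair i ` Field B)"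
      by (intro finite_UN_I I(2) fin subsetD[OF lin_interval_subset_Field])
    moreover have "lin_interval ?S x y \<subseteq> (\<Union>i\<in>?J. Pair i ` Field B)"
      using I(1)
      by (cases x; cases y)
        (fastforce simp: lin_interval_def lin_prod_def in_lin_sum dest: Linear_order_reflD)
    ultimately have "finite ((\<lambda>z. hausdorff_sim ?S n `` {z}) ` lin_interval ?S x y)"
      by (metis finite_subset image_UN image_mono)
    then show ?thesis
      using xy by (auto simp: hausdorff_sim_iff)
  qed
  then have "hausdorff_sim ?S (Suc n) `` {z} = Field ?S" if "z \<in> Field ?S" for z
    using that equiv_type[OF equiv_hausdorff_sim[OF lin, of "Suc n"]] by blast
  then have "(\<lambda>z. hausdorff_sim ?S (Suc n) `` {z}) ` Field ?S \<subseteq> {Field ?S}"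
    by auto
  then show ?thesis
    unfolding finite_hausdorff_rank_iff by (meson finite.emptyI finite.insertI finite_subset)
qed

lemma finite_hausdorff_rank_finite: "finite (Field L) \<Longrightarrow> finite_hausdorff_rank L"
  by (simp add: finite_hausdorff_rank_iff)

text \<open>No two points of a copy of the rationals are ever identified: the interval between them
  contains infinitely many points of the copy, which already lie in distinct classes.\<close>

lemma scattered_if_finite_hausdorff_rank:
  assumes "finite_hausdorff_rank L"
  shows "scattered L"
  unfolding scattered_def
proof
  have F: "Field {(p :: rat, q). p \<le> q} = UNIV"
    by (auto simp: Field_def)
  assume "lin_embeds {(p :: rat, q). p \<le> q} L"
  then obtain f :: "rat \<Rightarrow> 'a" where
    f: "inj f" "range f \<subseteq> Field L" "\<And>p q. p \<le> q \<longleftrightarrow> (f p, f q) \<in> L"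
    unfolding lin_embeds_def F by auto
  have eq: "f p \<in> hausdorff_sim L n `` {f q}"
    if "hausdorff_sim L n `` {f p} = hausdorff_sim L n `` {f q}" for p q and n :: nat
    unfolding that[symmetric] using f(2) by (auto simp: hausdorff_sim_iff)
  have sep: "p = q" if "(f p, f q) \<in> hausdorff_sim L n" for p q and n :: nat
    using that
  proof (induction n arbitrary: p q rule: less_induct)
    case (less n)
    show ?case
    proof (rule ccontr)
      assume "p \<noteq> q"
      then obtain m where m: "m < n"
        "finite ((\<lambda>z. hausdorff_sim L m `` {z}) ` lin_interval L (f p) (f q))"
        using less.prems f(1) by (auto simp: hausdorff_sim_iff inj_eq)
      \<comment> \<open>The relation does not tell which of \<open>p\<close> and \<open>q\<close> is
        smaller.\<close>
      let ?J = "{min p q<..<max p q}"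
      have "f ` ?J \<subseteq> lin_interval L (f p) (f q)"
        by (auto simp: lin_interval_def f(3)[symmetric] min_def max_def split: if_splits)
      then have "finite ((\<lambda>z. hausdorff_sim L m `` {z}) ` f ` ?J)"
        using m(2) by (meson finite_subset image_mono)
      then have "finite ((\<lambda>r. hausdorff_sim L m `` {f r}) ` ?J)"
        by (simp add: image_image)
      moreover have "inj_on (\<lambda>r. hausdorff_sim L m `` {f r}) ?J"
        using less.IH[OF m(1)] eq by (intro inj_onI) (metis Image_singleton_iff)
      ultimately have "finite ?J"
        by (rule finite_imageD)
      then show False
        using infinite_Ioo[of "min p q" "max p q"] \<open>p \<noteq> q\<close> by auto
    qed
  qed
  obtain n :: nat where n: "finite ((\<lambda>z. hausdorff_sim L n `` {z}) ` Field L)"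
    using assms by (auto simp: finite_hausdorff_rank_iff)
  have "finite (range (\<lambda>r. hausdorff_sim L n `` {f r}))"
    by (rule finite_subset[OF _ n]) (use f(2) in auto)
  moreover have "inj (\<lambda>r. hausdorff_sim L n `` {f r})"
    using sep eq by (intro injI) (metis Image_singleton_iff)
  ultimately show False
    using finite_imageD infinite_UNIV_char_0 by blast
qed


section \<open>Products with \<open>\<omega>\<close> and its reverse\<close>

lemma imm_succ_natLeq: "imm_succ natLeq i j \<longleftrightarrow> j = Suc i"
proof
  assume "imm_succ natLeq i j"
  then have "i < j" and between: "\<And>z. i \<le> z \<Longrightarrow> z \<le> j \<Longrightarrow> z = i \<or> z = j"
    by (auto simp: imm_succ_def natLeq_def)
  then show "j = Suc i"
    using between[of "Suc i"] by simp
qed (auto simp: imm_succ_def natLeq_def)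

lemma lin_min_natLeq: "lin_min natLeq i \<longleftrightarrow> i = 0"
  by (auto simp: lin_min_def Field_natLeq) (auto simp: natLeq_def)

lemma not_lin_max_natLeq: "\<not> lin_max natLeq i"
  unfolding lin_max_def Field_natLeq by (auto simp: natLeq_def intro!: exI[of _ "Suc i"])

lemma discrete_natLeq: "discrete natLeq"
  unfolding discrete_def lin_min_natLeq imm_succ_natLeq by (auto simp: gr0_conv_Suc)

lemma imm_succ_natLeq_on: "imm_succ (natLeq_on w) i j \<longleftrightarrow> j = Suc i \<and> j < w"
proof
  assume "imm_succ (natLeq_on w) i j"
  then have "i < j" "j < w"
    and between: "\<And>z. z < w \<Longrightarrow> i \<le> z \<Longrightarrow> z \<le> j \<Longrightarrow> z = i \<or> z = j"
    by (auto simp: imm_succ_def)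
  then show "j = Suc i \<and> j < w"
    using between[of "Suc i"] by simp
qed (auto simp: imm_succ_def)

lemma lin_min_natLeq_on: "lin_min (natLeq_on w) i \<longleftrightarrow> i = 0 \<and> 0 < w"
  unfolding lin_min_def Field_natLeq_on by auto

lemma lin_max_natLeq_on: "lin_max (natLeq_on w) i \<longleftrightarrow> Suc i = w"
  unfolding lin_max_def Field_natLeq_on by (auto dest: spec[of _ "w - 1"])

lemma discrete_natLeq_on: "discrete (natLeq_on w)"
  unfolding discrete_def lin_min_natLeq_on lin_max_natLeq_on imm_succ_natLeq_on Field_natLeq_on
  by (auto simp: not0_implies_Suc Suc_lessI)

lemma Linear_order_omega_sign: "Linear_order (omega_sign e)"
  by (cases e) (auto simp: natLeq_Linear_order)

lemma discrete_omega_sign: "discrete (omega_sign e)"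
  by (cases e) (auto simp: discrete_natLeq discrete_converse)

text \<open>Intervals have unordered end points, so reversing \<omega> leaves them unchanged and one
  bound serves both signs.\<close>

lemma finite_lin_interval_omega_sign: "finite (lin_interval (omega_sign e) i j)"
  by (rule finite_subset[of _ "{..max i j}"]) (cases e; auto simp: lin_interval_def natLeq_def)+

lemma Linear_order_lin_prod: "Linear_order A \<Longrightarrow> Linear_order B \<Longrightarrow> Linear_order (lin_prod A B)"
  by (simp add: lin_prod_def Linear_order_lin_sum)

lemma lin_prod_converse: "lin_prod (A\<inverse>) (B\<inverse>) = (lin_prod A B)\<inverse>"
  by (simp add: lin_prod_def lin_sum_converse)

text \<open>Boundedness puts end points on both sides of every cut between copies. One end would not
  do: in \<omega> \<times> \<omega> the first point of each later copy has no predecessor.\<close>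

lemma discrete_lin_prod:
  assumes "Linear_order A" "discrete A" "Linear_order B" "discrete B" "lin_bounded B"
  shows "discrete (lin_prod A B)"
  unfolding lin_prod_def using assms by (intro discrete_lin_sum) (auto simp: lin_bounded_def)

lemma indecomposable_omega_prod:
  assumes "Linear_order L"
  shows "indecomposable TYPE('b) TYPE('c) (lin_prod natLeq L)"
proof (rule indecomposable_if_self_embeddings_above)
  let ?P = "lin_prod natLeq L"
  have F: "Field ?P = UNIV \<times> Field L"
    using assms by (simp add: lin_prod_def Field_lin_sum Field_natLeq)
  have P: "((i, a), (j, b)) \<in> ?P \<longleftrightarrow>
      a \<in> Field L \<and> b \<in> Field L \<and> (i < j \<or> i = j \<and> (a, b) \<in> L)" for i a j b
    by (auto simp: lin_prod_def in_lin_sum Field_natLeq) (auto simp: natLeq_def)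
  fix x assume x: "x \<in> Field ?P"
  show "\<exists>g. inj_on g (Field ?P) \<and> g ` Field ?P \<subseteq> {y. (x, y) \<in> ?P} \<and>
      (\<forall>a\<in>Field ?P. \<forall>b\<in>Field ?P. (a, b) \<in> ?P \<longleftrightarrow> (g a, g b) \<in> ?P)"
    \<comment> \<open>Shifting by \<open>Suc (fst x)\<close> moves every point into a copy strictly
      after that of \<open>x\<close>; a shift by \<open>fst x\<close> could leave points of the same
      copy below \<open>x\<close>.\<close>
    by (rule exI[of _ "\<lambda>(i, a). (i + Suc (fst x), a)"], cases x)
      (use x in \<open>auto simp: F P inj_on_def\<close>)
qed

lemma indecomposable_omega_sign_prod:
  assumes "Linear_order L"
  shows "indecomposable TYPE('b) TYPE('c) (lin_prod (omega_sign e) L)"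
proof (cases e)
  case Plus
  then show ?thesis
    using indecomposable_omega_prod[OF assms] by simp
next
  case Minus
  \<comment> \<open>Reversal acts on both factors, so \<open>L\<close> is reversed
    beforehand.\<close>
  have "indecomposable TYPE('b) TYPE('c) ((lin_prod natLeq (L\<inverse>))\<inverse>)"
    using assms by (intro indecomposable_converse indecomposable_omega_prod) simp
  then show ?thesis
    using Minus by (simp flip: lin_prod_converse)
qed

lemma ends_omega_sign_prod:
  assumes "Linear_order L" "lin_bounded L"
  shows "Ex (lin_min (lin_prod (omega_sign e) L)) \<longleftrightarrow> e = Plus"
    and "Ex (lin_max (lin_prod (omega_sign e) L)) \<longleftrightarrow> e = Minus"
proof -
  \<comment> \<open>Stated for every bounded \<open>K\<close>, because the negative sign applies it
    to the reverse of \<open>L\<close>, where the two kinds of end point trade roles.\<close>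
  have min: "Ex (lin_min (lin_prod natLeq K))" and max: "\<not> Ex (lin_max (lin_prod natLeq K))"
    if K: "Linear_order K" "lin_bounded K" for K :: "'a rel"
  proof -
    show "Ex (lin_min (lin_prod natLeq K))"
      using K lin_min_lin_sum[of natLeq "\<lambda>_. K"] lin_min_natLeq
      by (auto simp: lin_prod_def lin_bounded_def)
    have "Field K \<noteq> {}"
      using K(2) by (auto simp: lin_bounded_def lin_min_def)
    then show "\<not> Ex (lin_max (lin_prod natLeq K))"
      using K not_lin_max_lin_sum[of natLeq "\<lambda>_. K"] natLeq_Linear_order not_lin_max_natLeq
      by (auto simp: lin_prod_def)
  qed
  have conv: "lin_prod (natLeq\<inverse>) L = (lin_prod natLeq (L\<inverse>))\<inverse>"
    by (simp flip: lin_prod_converse)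
  have "Linear_order (L\<inverse>)" "lin_bounded (L\<inverse>)"
    using assms by (auto simp: lin_bounded_def lin_min_converse lin_max_converse)
  then show "Ex (lin_min (lin_prod (omega_sign e) L)) \<longleftrightarrow> e = Plus"
    "Ex (lin_max (lin_prod (omega_sign e) L)) \<longleftrightarrow> e = Minus"
    using assms min max
    by (cases e; auto simp: conv lin_min_converse lin_max_converse)+
qed


section \<open>Alternating trees\<close>

lemma inj_case_prod_Cons: "inj (case_prod Cons)"
  by (auto simp: inj_def)

text \<open>The right factor in the recursion for \<open>LIN_at\<close>. It gets a name because the
  induction is about it, and at the root it is the order \<open>L\<close> of the theorem.\<close>

definition child_sum :: "nat list set \<Rightarrow> (nat list \<Rightarrow> sign) \<Rightarrow> nat list \<Rightarrow> nat list rel"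
  where "child_sum T s \<sigma> =
    (if width T \<sigma> = 0 then {([], [])}
     else dir_image (lin_sum (natLeq_on (width T \<sigma>)) (\<lambda>x. LIN_at T s (\<sigma> @ [x])))
       (case_prod Cons))"

lemma LIN_at_eq:
  "finite T \<Longrightarrow> \<sigma> \<in> T \<Longrightarrow>
    LIN_at T s \<sigma> = dir_image (lin_prod (omega_sign (s \<sigma>)) (child_sum T s \<sigma>)) (case_prod Cons)"
  by (subst LIN_at.simps) (simp add: child_sum_def)

text \<open>The invariant of the induction up the tree.\<close>

definition bounded_discrete_finite_rank :: "'a rel \<Rightarrow> bool"
  where "bounded_discrete_finite_rank L \<longleftrightarrow>
    Linear_order L \<and> lin_bounded L \<and> discrete L \<and> finite_hausdorff_rank L"

lemma bounded_discrete_finite_rank_dir_image: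
  assumes "inj f" "bounded_discrete_finite_rank L"
  shows "bounded_discrete_finite_rank (dir_image L f)"
proof -
  have L: "Linear_order L" "lin_bounded L" "discrete L" "finite_hausdorff_rank L"
    using assms(2) by (simp_all add: bounded_discrete_finite_rank_def)
  have "lin_bounded (dir_image L f)"
    using L(2) by (simp add: lin_bounded_def Ex_lin_min_dir_image Ex_lin_max_dir_image assms(1))
  then show ?thesis
    unfolding bounded_discrete_finite_rank_def
    using Linear_order_dir_image[OF L(1) inj_on_subset[OF assms(1) subset_UNIV]]
      discrete_dir_image[OF assms(1) L(3)] finite_hausdorff_rank_dir_image[OF assms(1) L(1,4)]
    by blast
qed

text \<open>Passes from a child sum to the order at its node, for each child in the induction and
  for the root in the theorem. \<open>P\<close> has one end only, so the invariant itself is lost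
  here and has to be restored by the next sum.\<close>

lemma flattened_omega_sign_prod:
  fixes L :: "nat list rel" and e :: sign
  assumes "bounded_discrete_finite_rank L"
  defines "P \<equiv> dir_image (lin_prod (omega_sign e) L) (case_prod Cons)"
  shows "Linear_order P" "discrete P" "finite_hausdorff_rank P"
    "Ex (lin_min P) \<longleftrightarrow> e = Plus" "Ex (lin_max P) \<longleftrightarrow> e = Minus"
proof -
  note L = assms(1)[unfolded bounded_discrete_finite_rank_def]
  have prod: "Linear_order (lin_prod (omega_sign e) L)"
    using L by (simp add: Linear_order_lin_prod Linear_order_omega_sign)
  show "Linear_order P"
    unfolding P_def
    by (rule Linear_order_dir_image[OF prod inj_on_subset[OF inj_case_prod_Cons subset_UNIV]])
  show "discrete P"
    unfolding P_def using L
    by (simp add: discrete_dir_image inj_case_prod_Cons discrete_lin_prod Linear_order_omega_sign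
        discrete_omega_sign)
  show "finite_hausdorff_rank P"
    unfolding P_def using L prod
    by (simp add: finite_hausdorff_rank_dir_image inj_case_prod_Cons finite_hausdorff_rank_lin_prod
        Linear_order_omega_sign finite_lin_interval_omega_sign)
  show "Ex (lin_min P) \<longleftrightarrow> e = Plus" "Ex (lin_max P) \<longleftrightarrow> e = Minus"
    unfolding P_def using L ends_omega_sign_prod
    by (metis Ex_lin_min_dir_image Ex_lin_max_dir_image inj_case_prod_Cons)+
qed

text \<open>Between consecutive children of signs \<open>+, -\<close> the cut has neither a last element on its
  left nor a first one on its right, between consecutive children of signs \<open>-, +\<close> it has both.
  As the width is even, the first child is \<open>+\<close> and the last one \<open>-\<close>, which gives the end points.\<close>

lemma bounded_discrete_finite_rank_child_sum:
  assumes T: "finite T" "standard_labelling T" "alternating T s"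
  shows "\<sigma> \<in> T \<Longrightarrow> bounded_discrete_finite_rank (child_sum T s \<sigma>)"
proof (induction "card {\<tau> \<in> T. prefix \<sigma> \<tau>}" arbitrary: \<sigma> rule: less_induct)
  case less
  define w where "w = width T \<sigma>"
  define R where "R x = LIN_at T s (\<sigma> @ [x])" for x
  have even: "even w" and sign: "\<And>x. x < w \<Longrightarrow> s (\<sigma> @ [x]) = (if even x then Plus else Minus)"
    using T(3) less.prems by (auto simp: alternating_def w_def)
  show ?case
  proof (cases "w = 0")
    case True
    \<comment> \<open>At a leaf, reading the empty sum as one point is what makes it bounded; the
      empty order has no end points.\<close>
    have "Field {([] :: nat list, [] :: nat list)} = {[]}"
      by (auto simp: Field_def)
    then have "bounded_discrete_finite_rank {([] :: nat list, [])}"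
      by (auto simp: bounded_discrete_finite_rank_def lin_bounded_def discrete_def lin_min_def
          lin_max_def finite_hausdorff_rank_finite intro: Linear_orderI)
    then show ?thesis
      using True by (simp add: child_sum_def w_def)
  next
    case False
    have child: "Linear_order (R x)" "discrete (R x)" "finite_hausdorff_rank (R x)"
      "Ex (lin_min (R x)) \<longleftrightarrow> even x" "Ex (lin_max (R x)) \<longleftrightarrow> odd x" if x: "x < w" for x
    proof -
      have mem: "\<sigma> @ [x] \<in> T"
        using T(2) less.prems x by (auto simp: standard_labelling_def w_def)
      \<comment> \<open>The number of nodes extending the current one drops at a child, because
        \<sigma> itself is no longer counted.\<close>
      have "\<sigma> \<in> {\<tau> \<in> T. prefix \<sigma> \<tau>}" "\<sigma> \<notin> {\<tau> \<in> T. prefix (\<sigma> @ [x]) \<tau>}"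
        using less.prems by (auto dest: prefix_length_le)
      moreover have "{\<tau> \<in> T. prefix (\<sigma> @ [x]) \<tau>} \<subseteq> {\<tau> \<in> T. prefix \<sigma> \<tau>}"
        by (auto dest: append_prefixD)
      ultimately have "{\<tau> \<in> T. prefix (\<sigma> @ [x]) \<tau>} \<subset> {\<tau> \<in> T. prefix \<sigma> \<tau>}"
        by blast
      then have "card {\<tau> \<in> T. prefix (\<sigma> @ [x]) \<tau>} < card {\<tau> \<in> T. prefix \<sigma> \<tau>}"
        using T(1) by (intro psubset_card_mono) auto
      then have "bounded_discrete_finite_rank (child_sum T s (\<sigma> @ [x]))"
        using less.hyps mem by blast
      from flattened_omega_sign_prod[OF this, of "s (\<sigma> @ [x])"]
      show "Linear_order (R x)" "discrete (R x)" "finite_hausdorff_rank (R x)"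
        "Ex (lin_min (R x)) \<longleftrightarrow> even x" "Ex (lin_max (R x)) \<longleftrightarrow> odd x"
        using sign[OF x] by (auto simp: R_def LIN_at_eq[OF T(1) mem])
    qed
    let ?S = "lin_sum (natLeq_on w) R"
    have F: "Field (natLeq_on w) = {x. x < w}"
      by (rule Field_natLeq_on)
    have I: "Linear_order (natLeq_on w)"
      using natLeq_on_Well_order[of w] by (simp add: well_order_on_def)
    have S: "Linear_order ?S"
      using I child(1) by (intro Linear_order_lin_sum) (auto simp: F)
    \<comment> \<open>At the cut between \<open>i\<close> and \<open>Suc i\<close> both sides of the
      condition reduce to \<open>odd i\<close>.\<close>
    have disc: "discrete ?S"
      using I child discrete_natLeq_on
      by (intro discrete_lin_sum) (auto simp: F imm_succ_natLeq_on)
    have rank: "finite_hausdorff_rank ?S"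
      using I child by (intro finite_hausdorff_rank_lin_sum) (auto simp: F)
    have odd: "odd (w - 1)"
      using even False by (cases w) auto
    have "Ex (lin_min ?S)"
    proof -
      obtain a where "lin_min (R 0) a"
        using child(4)[of 0] False by auto
      then show ?thesis
        using lin_min_lin_sum[of "natLeq_on w" R 0 a] child(1) False
        by (auto simp: F lin_min_natLeq_on)
    qed
    moreover have "Ex (lin_max ?S)"
    proof -
      obtain a where "lin_max (R (w - 1)) a"
        using child(5)[of "w - 1"] odd False by auto
      then show ?thesis
        using lin_max_lin_sum[of "natLeq_on w" R "w - 1" a] child(1) False
        by (auto simp: F lin_max_natLeq_on)
    qed
    ultimately have "bounded_discrete_finite_rank ?S"
      using S disc rank by (simp add: bounded_discrete_finite_rank_def lin_bounded_def)
    then have "bounded_discrete_finite_rank (dir_image ?S (case_prod Cons))"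
      by (rule bounded_discrete_finite_rank_dir_image[OF inj_case_prod_Cons])
    then show ?thesis
      using False unfolding child_sum_def w_def R_def[abs_def] by simp
  qed
qed

theorem theorem4p3:
  fixes T :: "nat list set" and s :: "nat list \<Rightarrow> sign"
  assumes "finite_tree T" and "standard_labelling T" and "alternating T s"
  shows "(\<exists>L :: nat list rel.
            Linear_order L \<and> lin_bounded L \<and> countable (Field L) \<and> discrete L \<and>
            finite_hausdorff_rank L \<and>
            lin_iso (LIN T s) (lin_prod (omega_sign (s [])) L)) \<and>
         Linear_order (LIN T s) \<and> countable (Field (LIN T s)) \<and> discrete (LIN T s) \<and>
         indecomposable TYPE('b) TYPE('c) (LIN T s) \<and> scattered (LIN T s) \<and>
         finite_hausdorff_rank (LIN T s)"
proof -
  have T: "finite T" "[] \<in> T"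
    using assms(1) by (auto simp: finite_tree_def)
  define L where "L = child_sum T s []"
  have LIN: "LIN T s = dir_image (lin_prod (omega_sign (s [])) L) (case_prod Cons)"
    unfolding LIN_def L_def by (rule LIN_at_eq[OF T])
  have good: "bounded_discrete_finite_rank L"
    unfolding L_def using bounded_discrete_finite_rank_child_sum[OF T(1) assms(2,3) T(2)] .
  then have L: "Linear_order L" "lin_bounded L" "discrete L" "finite_hausdorff_rank L"
    by (auto simp: bounded_discrete_finite_rank_def)
  have iso: "lin_iso (LIN T s) (lin_prod (omega_sign (s [])) L)"
    unfolding LIN by (rule lin_iso_dir_image[OF inj_case_prod_Cons])
  note P = flattened_omega_sign_prod[OF good, of "s []", folded LIN]
  have "indecomposable TYPE('b) TYPE('c) (LIN T s)"
    unfolding LIN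
    by (intro indecomposable_dir_image inj_case_prod_Cons indecomposable_omega_sign_prod L)
  \<comment> \<open>Countability is that of the type \<open>nat list\<close>.\<close>
  then show ?thesis
    using L iso P scattered_if_finite_hausdorff_rank[OF P(3)] countableI_type by blast
qed

end
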